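(* Let $m-1$ be a prime power and let $\Phi$ be the Singer equiangular tight frame in $\mathbb C^m$. Any set of $n$ distinct points and positive weights satisfying the weighted $L_2$ Marcinkiewicz--Zygmund inequality on the $m$-dimensional space $\mathcal F_\Phi$ with distortion $0\le\varepsilon<1$ obeys $$n\ge\max\Big\{m,\frac{(m^2-m+1)(1-\varepsilon^2)}{1+(m-1)\varepsilon^2}\Big\}.$$
   Context: Let $q=m-1$ be a prime power and $N=q^2+q+1=m^2-m+1$. A subset $D\subset\mathbb Z_N$ is an $(N,q+1,1)$ difference set if $|D|=q+1$ and every nonzero element of $\mathbb Z_N$ has exactly one representation as $d_1-d_2$ with $d_1,d_2\in D$. A Singer difference set is the $(N,q+1,1)$ difference set in $\mathbb Z_N$ given by Singer's construction: $D=\{k\in\mathbb Z_N:\operatorname{Tr}_{\mathbb F_{q^3}/\mathbb F_q}(c\theta^k)=0\}$, where $\theta$ is a generator of $\mathbb F_{q^3}^\times$ and $c\in\mathbb F_{q^3}^\times$ (the condition depends only on $k$ modulo $N$). Fix a Singer difference set $D\subset\mathbb Z_N$ and put $\omega=\exp(2\pi\mathrm i/N)$. The Singer equiangular tight frame is the family $\Phi=\{\boldsymbol\varphi_i\}_{i\in\mathbb Z_N}$ of vectors $\boldsymbol\varphi_i=\frac1{\sqrt{q+1}}(\omega^{ik})_{k\in D}\in\mathbb C^D\cong\mathbb C^m$. On $\Omega=\mathbb Z_N$ with the counting measure define $\mathcal F_\Phi=\{f_{\boldsymbol a}:\Omega\to\mathbb C,\ f_{\boldsymbol a}(i)=\sqrt{m/N}\,\langle\boldsymbol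 a,\boldsymbol\varphi_i\rangle\,:\ \boldsymbol a\in\mathbb C^m\}$, with $\|f\|_{L_2}^2=\sum_{i\in\Omega}|f(i)|^2$. Distinct points $x_1,\dots,x_n\in\Omega$ and weights $w_1,\dots,w_n>0$ satisfy the weighted $L_2$ Marcinkiewicz--Zygmund inequality on $\mathcal F_\Phi$ with distortion $\varepsilon$ if $(1-\varepsilon)\|f\|_{L_2}^2\le\sum_{i=1}^nw_i|f(x_i)|^2\le(1+\varepsilon)\|f\|_{L_2}^2$ for all $f\in\mathcal F_\Phi$. *)

theory Defs
  imports
    "HOL-Analysis.Analysis"
    "HOL-Library.Cardinality"
    "HOL-Number_Theory.Prime_Powers"
begin

text \<open>
  The cyclic group of order \<open>N = q\<^sup>2 + q + 1\<close> is represented by the residues \<open>{..<N}\<close>.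
\<close>

definition singer_modulus :: "nat \<Rightarrow> nat" where
  "singer_modulus q = q ^ 2 + q + 1"

text \<open>
  Below, \<open>'a\<close> is a finite field with \<open>q ^ 3\<close> elements. Its subfield of order \<open>q\<close> is
  \<open>{x. x ^ q = x}\<close>, and the Galois group over that subfield is generated by \<open>x \<mapsto> x ^ q\<close>;
  the trace is the sum of the three conjugates \<open>x + x ^ q + x ^ (q ^ 2)\<close>.
\<close>

definition cubic_trace :: "nat \<Rightarrow> 'a::{field,finite} \<Rightarrow> 'a" where
  "cubic_trace q x = (\<Sum>j<3. x ^ (q ^ j))"

definition generates_units :: "'a::{field,finite} \<Rightarrow> bool" where
  "generates_units \<theta> \<longleftrightarrow> range (\<lambda>k::int. \<theta> powi k) = UNIV - {0}"

definition singer_set :: "nat \<Rightarrow> 'a::{field,finite} \<Rightarrow> 'a \<Rightarrow> nat set" where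
  "singer_set q \<theta> c = {k \<in> {..<singer_modulus q}. cubic_trace q (c * \<theta> ^ k) = 0}"

text \<open>
  A vector with coordinates indexed by \<open>D\<close> is a function \<open>nat \<Rightarrow> complex\<close> of which only the
  values on \<open>D\<close> are ever used.
\<close>

definition inner_on :: "nat set \<Rightarrow> (nat \<Rightarrow> complex) \<Rightarrow> (nat \<Rightarrow> complex) \<Rightarrow> complex" where
  "inner_on D u v = (\<Sum>k\<in>D. u k * cnj (v k))"

definition singer_frame :: "nat \<Rightarrow> nat \<Rightarrow> nat \<Rightarrow> complex" where
  "singer_frame q i k =
     exp (2 * of_real pi * \<i> / of_nat (singer_modulus q)) ^ (i * k) / of_real (sqrt (real (q + 1)))"

text \<open>
  Functions on the cyclic group are likewise functions on \<open>nat\<close> evaluated only at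
  \<open>i < N\<close>. The dimension is \<open>m = q + 1\<close>.
\<close>

definition frame_function :: "nat \<Rightarrow> nat set \<Rightarrow> (nat \<Rightarrow> complex) \<Rightarrow> nat \<Rightarrow> complex" where
  "frame_function q D a i =
     of_real (sqrt (real (q + 1) / real (singer_modulus q))) * inner_on D a (singer_frame q i)"

definition frame_space :: "nat \<Rightarrow> nat set \<Rightarrow> (nat \<Rightarrow> complex) set" where
  "frame_space q D = range (frame_function q D)"

definition L2_norm_sq :: "nat \<Rightarrow> (nat \<Rightarrow> complex) \<Rightarrow> real" where
  "L2_norm_sq N f = (\<Sum>i<N. (cmod (f i))\<^sup>2)"

definition weighted_MZ ::
  "nat \<Rightarrow> (nat \<Rightarrow> complex) set \<Rightarrow> nat \<Rightarrow> (nat \<Rightarrow> nat) \<Rightarrow> (nat \<Rightarrow> real) \<Rightarrow> real \<Rightarrow> bool" where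
  "weighted_MZ N F n x w \<epsilon> \<longleftrightarrow>
     (\<forall>f\<in>F. (1 - \<epsilon>) * L2_norm_sq N f \<le> (\<Sum>i=1..n. w i * (cmod (f (x i)))\<^sup>2) \<and>
            (\<Sum>i=1..n. w i * (cmod (f (x i)))\<^sup>2) \<le> (1 + \<epsilon>) * L2_norm_sq N f)"

end

theory Submission
  imports Defs "HOL-Number_Theory.Residues"
begin

text \<open>
  Put \<open>q = m - 1\<close> and \<open>N = q\<^sup>2 + q + 1\<close>. Two facts about the Singer set \<open>D\<close> are used: it has
  \<open>q + 1\<close> elements, and every nontrivial character sum over \<open>D\<close> has squared modulus \<open>q\<close>. Both
  follow by counting differences once \<open>D\<close> is known to be a perfect difference set
  (\<open>singer_perfect_difference_set\<close>). That in turn amounts to saying that two distinct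
  hyperplanes \<open>Tr (c y) = 0\<close> and \<open>Tr (b y) = 0\<close> of the cubic extension meet in a line. A spanning
  vector of the line is written down explicitly, as a cross product of the vectors of conjugates
  of \<open>c\<close> and \<open>b\<close>; eliminating \<open>y ^ q\<^sup>2\<close> from the two equations shows that \<open>y ^ (q - 1)\<close> is
  determined, hence that \<open>y\<close> is unique up to the subfield.

  By Parseval's identity, the Marcinkiewicz--Zygmund inequality says that the frame operator
  \<open>A = (\<Sum>i. u\<^sub>i e\<^sub>i e\<^sub>i*)\<close>, with \<open>u\<^sub>i = w\<^sub>i / N\<close> and \<open>e\<^sub>i\<close> the unnormalised frame vectors at the points,
  satisfies \<open>(1 - \<epsilon>) I \<le> A \<le> (1 + \<epsilon>) I\<close>. The lower bound makes the \<open>e\<^sub>i\<close> span, so \<open>n \<ge> m\<close>.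
  Moreover the operator norm of \<open>A - I\<close> is at most \<open>\<epsilon>\<close>, so its squared Frobenius norm is at most
  \<open>\<epsilon>\<^sup>2 m\<close>, that is, \<open>tr (A\<^sup>2) \<le> 2 tr A - (1 - \<epsilon>\<^sup>2) m\<close> (\<open>frame_potential_bound\<close>). With
  \<open>W = (\<Sum>i. u\<^sub>i)\<close> and \<open>S = (\<Sum>i. u\<^sub>i\<^sup>2)\<close>, equiangularity gives \<open>tr A = m W\<close> and
  \<open>tr (A\<^sup>2) = q W\<^sup>2 + N S\<close>, while \<open>S \<ge> W\<^sup>2 / n\<close> by Cauchy--Schwarz. Writing \<open>\<delta> = 1 - \<epsilon>\<^sup>2\<close> and using
  \<open>\<delta> (2 W - \<delta>) \<le> W\<^sup>2\<close>, the weights cancel and \<open>\<delta> (n q + N) \<le> n m\<close> remains, which is the second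
  bound.
\<close>

section \<open>Perfect difference sets and their character sums\<close>

text \<open>
  An \<open>(N, k, 1)\<close> difference set in the residues \<open>{..<N}\<close>, with no condition on its size: every
  nonzero residue is a difference of two elements of \<open>D\<close> in exactly one way. A representation
  of \<open>d\<close> is recorded by its subtrahend \<open>k\<close>, the minuend being \<open>k + d\<close> modulo \<open>N\<close>.
\<close>

definition perfect_difference_set :: "nat \<Rightarrow> nat set \<Rightarrow> bool" where
  "perfect_difference_set N D \<longleftrightarrow>
     D \<subseteq> {..<N} \<and> (\<forall>d\<in>{1..<N}. \<exists>!k. k \<in> D \<and> (k + d) mod N \<in> D)"

lemma perfect_difference_set_bij:
  assumes "perfect_difference_set N D"
  shows "bij_betw (\<lambda>(k, l). (l + N - k) mod N) {(k, l) \<in> D \<times> D. k \<noteq> l} {1..<N}"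
proof -
  have sub: "k < N" if "k \<in> D" for k
    using assms that by (auto simp: perfect_difference_set_def)
  have uniq: "\<exists>!k. k \<in> D \<and> (k + d) mod N \<in> D" if "d \<in> {1..<N}" for d
    using assms that by (simp add: perfect_difference_set_def)
  have range: "(l + N - k) mod N \<in> {1..<N}" and translate: "(k + (l + N - k) mod N) mod N = l"
    if "k \<in> D" "l \<in> D" "k \<noteq> l" for k l
  proof -
    have kl: "k < N" "l < N" using that sub by auto
    have eq: "(l + N - k) mod N = (if l < k then l + N - k else l - k)"
    proof (cases "l < k")
      case False
      then have "(l + N - k) mod N = (l - k + N) mod N" by simp
      also have "\<dots> = (l - k) mod N" by (rule mod_add_self2)
      finally show ?thesis using False kl by simp
    qed (use kl in auto)
    show "(l + N - k) mod N \<in> {1..<N}" unfolding eq using kl that(3) by auto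
    show "(k + (l + N - k) mod N) mod N = l" unfolding eq using kl by auto
  qed
  show ?thesis
    unfolding bij_betw_def
  proof
    show "inj_on (\<lambda>(k, l). (l + N - k) mod N) {(k, l) \<in> D \<times> D. k \<noteq> l}"
    proof (rule inj_onI, clarify)
      fix k l k' l'
      assume D: "k \<in> D" "l \<in> D" "k' \<in> D" "l' \<in> D" and ne: "k \<noteq> l" "k' \<noteq> l'"
        and eq: "(l + N - k) mod N = (l' + N - k') mod N"
      define d where "d = (l + N - k) mod N"
      have "d \<in> {1..<N}" using range[OF D(1,2) ne(1)] by (simp add: d_def)
      moreover have l: "(k + d) mod N = l" "(k' + d) mod N = l'"
        using translate[OF D(1,2) ne(1)] translate[OF D(3,4) ne(2)] eq by (simp_all add: d_def)
      ultimately have "k = k'" using uniq D by metis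
      then show "k = k' \<and> l = l'" using l by simp
    qed
    show "(\<lambda>(k, l). (l + N - k) mod N) ` {(k, l) \<in> D \<times> D. k \<noteq> l} = {1..<N}"
    proof (intro subset_antisym subsetI)
      fix d assume d: "d \<in> {1..<N}"
      obtain k where k: "k \<in> D" "(k + d) mod N \<in> D" using uniq[OF d] by blast
      define l where "l = (k + d) mod N"
      have l_eq: "l = (if k + d < N then k + d else k + d - N)"
        using sub[OF k(1)] d by (auto simp: l_def mod_if)
      have "k \<noteq> l" using l_eq d by auto
      moreover have "(l + N - k) mod N = d"
      proof (cases "k + d < N")
        case True
        then have "l + N - k = d + N" using l_eq by simp
        then show ?thesis using d by simp
      next
        case False
        then have "l + N - k = d" using l_eq by simp
        then show ?thesis using d by simp
      qed
      ultimately show "d \<in> (\<lambda>(k, l). (l + N - k) mod N) ` {(k, l) \<in> D \<times> D. k \<noteq> l}"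
        using k by (intro image_eqI[of _ _ "(k, l)"]) (auto simp: l_def)
    qed (use range in auto)
  qed
qed

text \<open>
  Expanding the square gives one term \<open>z ^ (l - k)\<close> for each pair \<open>(k, l)\<close>: the diagonal
  contributes \<open>card D\<close>, and the remaining pairs hit each nonzero residue once.
\<close>

lemma perfect_difference_set_character_sum:
  fixes z :: complex
  assumes D: "perfect_difference_set N D" and N: "N > 0" and z: "z ^ N = 1"
  shows "complex_of_real ((cmod (\<Sum>k\<in>D. z ^ k))\<^sup>2) = of_nat (card D) + (\<Sum>d\<in>{1..<N}. z ^ d)"
proof -
  have sub: "k < N" if "k \<in> D" for k
    using D that by (auto simp: perfect_difference_set_def)
  have fin: "finite D" using D by (auto simp: perfect_difference_set_def intro: finite_subset)
  have fin_pairs: "finite {(k, l) \<in> D \<times> D. P k l}" for P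
    by (rule finite_subset[of _ "D \<times> D"]) (use fin in auto)
  have "cmod z ^ N = 1" using z by (simp flip: norm_power)
  then have "cmod z = 1" using power_eq_imp_eq_base[of "cmod z" N 1] N by simp
  then have unit: "z ^ k * cnj (z ^ k) = 1" for k
    using complex_norm_square[of "z ^ k"] by (simp add: norm_power)
  have quot: "z ^ l * cnj (z ^ k) = z ^ ((l + N - k) mod N)" if "k \<in> D" for k l
  proof -
    have "z ^ ((l + N - k) mod N) = z ^ (N * ((l + N - k) div N) + (l + N - k) mod N)"
      by (simp only: power_add power_mult z) simp
    also have "\<dots> = z ^ (l + N - k)" by simp
    also have "\<dots> = z ^ (l + N - k) * (z ^ k * cnj (z ^ k))" by (simp add: unit del: complex_cnj_power)
    also have "\<dots> = z ^ (l + N - k + k) * cnj (z ^ k)" by (simp add: power_add)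
    also have "l + N - k + k = l + N" using sub[OF that] by simp
    finally show ?thesis by (simp add: power_add z)
  qed
  have "complex_of_real ((cmod (\<Sum>k\<in>D. z ^ k))\<^sup>2) = (\<Sum>k\<in>D. z ^ k) * cnj (\<Sum>k\<in>D. z ^ k)"
    by (rule complex_norm_square)
  also have "\<dots> = (\<Sum>(k, l)\<in>D \<times> D. z ^ l * cnj (z ^ k))"
    by (simp only: cnj_sum sum_product, subst sum.swap, simp only: sum.cartesian_product)
  also have "\<dots> = (\<Sum>(k, l)\<in>{(k, l) \<in> D \<times> D. k = l}. z ^ l * cnj (z ^ k))
      + (\<Sum>(k, l)\<in>{(k, l) \<in> D \<times> D. k \<noteq> l}. z ^ l * cnj (z ^ k))"
    by (subst sum.union_disjoint[symmetric, OF fin_pairs fin_pairs]) (auto intro!: sum.cong)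
  also have "{(k, l) \<in> D \<times> D. k = l} = (\<lambda>k. (k, k)) ` D" by auto
  also have "(\<Sum>(k, l)\<in>(\<lambda>k. (k, k)) ` D. z ^ l * cnj (z ^ k)) = of_nat (card D)"
    by (subst sum.reindex) (auto simp: inj_on_def unit simp del: complex_cnj_power)
  also have "(\<Sum>(k, l)\<in>{(k, l) \<in> D \<times> D. k \<noteq> l}. z ^ l * cnj (z ^ k))
      = (\<Sum>kl\<in>{(k, l) \<in> D \<times> D. k \<noteq> l}. z ^ (case kl of (k, l) \<Rightarrow> (l + N - k) mod N))"
    by (rule sum.cong) (auto simp: quot simp del: complex_cnj_power)
  also have "\<dots> = (\<Sum>d\<in>{1..<N}. z ^ d)"
    by (rule sum.reindex_bij_betw[OF perfect_difference_set_bij[OF D]])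
  finally show ?thesis .
qed

lemma perfect_difference_set_card:
  assumes "perfect_difference_set (q ^ 2 + q + 1) D" and "q > 0"
  shows "card D = q + 1"
proof -
  have "complex_of_real ((cmod (of_nat (card D)))\<^sup>2) = of_nat (card D) + of_nat (q ^ 2 + q)"
    using perfect_difference_set_character_sum[OF assms(1), of 1] by simp
  then have "complex_of_nat ((card D)\<^sup>2) = of_nat (card D + (q ^ 2 + q))" by simp
  then have eq: "(card D)\<^sup>2 = card D + (q ^ 2 + q)" by (simp only: of_nat_eq_iff)
  then have "(int (card D) - int q - 1) * (int (card D) + int q) = 0"
    by (simp add: algebra_simps power2_eq_square flip: of_nat_mult of_nat_add)
  then show ?thesis using \<open>q > 0\<close> by auto
qed

lemma perfect_difference_set_character_sum_nontrivial:
  fixes z :: complex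
  assumes D: "perfect_difference_set N D" and N: "N > 0" and z: "z ^ N = 1" "z \<noteq> 1"
  shows "(cmod (\<Sum>k\<in>D. z ^ k))\<^sup>2 = real (card D) - 1"
proof -
  have "(\<Sum>d<N. z ^ d) = 0" using z geometric_sum[of z N] by simp
  moreover have "(\<Sum>d<N. z ^ d) = 1 + (\<Sum>d\<in>{1..<N}. z ^ d)"
    using N sum.atLeast_Suc_lessThan[of 0 N "\<lambda>d. z ^ d"] by (simp add: atLeast0LessThan)
  ultimately have "(\<Sum>d\<in>{1..<N}. z ^ d) = -1" by (simp add: eq_neg_iff_add_eq_0 add.commute)
  then have "complex_of_real ((cmod (\<Sum>k\<in>D. z ^ k))\<^sup>2) = complex_of_real (real (card D) - 1)"
    using perfect_difference_set_character_sum[OF D N z(1)] by simp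
  then show ?thesis by (simp only: of_real_eq_iff)
qed

section \<open>Generators and Frobenius in a finite field\<close>

lemma generates_units_nonzero:
  fixes \<theta> :: "'a::{field,finite}"
  assumes "generates_units \<theta>"
  shows "\<theta> \<noteq> 0"
proof -
  have "\<theta> powi 1 \<in> range (\<lambda>k::int. \<theta> powi k)" by blast
  then show ?thesis using assms by (simp add: generates_units_def)
qed

lemma
  fixes \<theta> :: "'a::{field,finite}"
  assumes gen: "generates_units \<theta>"
  shows generator_surj: "y \<noteq> 0 \<Longrightarrow> \<exists>k. y = \<theta> ^ k"
    and generator_power_eq_1_iff: "\<theta> ^ t = 1 \<longleftrightarrow> CARD('a) - 1 dvd t"
proof -
  have nz: "\<theta> \<noteq> 0" using generates_units_nonzero[OF gen] .
  have cancel: "\<theta> ^ (b - a) = 1" if "\<theta> ^ a = \<theta> ^ b" "a \<le> b" for a b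
  proof -
    have "\<theta> ^ a * \<theta> ^ (b - a) = \<theta> ^ b" using that(2) by (simp flip: power_add)
    then have "\<theta> ^ a * \<theta> ^ (b - a) = \<theta> ^ a * 1" using that(1) by simp
    then show ?thesis using nz by simp
  qed
  have "\<not> inj (\<lambda>t::nat. \<theta> ^ t)"
    using finite_imageD[of "\<lambda>t::nat. \<theta> ^ t" UNIV] by auto
  then obtain a b :: nat where "a < b" "\<theta> ^ a = \<theta> ^ b"
    unfolding inj_def by (metis nat_neq_iff)
  then have ex: "\<exists>t>0. \<theta> ^ t = 1" using cancel[of a b] by (intro exI[of _ "b - a"]) auto
  define T where "T = (LEAST t. t > 0 \<and> \<theta> ^ t = 1)"
  have T: "T > 0" "\<theta> ^ T = 1" using LeastI_ex[OF ex] by (auto simp: T_def)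
  have least: "T \<le> t" if "t > 0" "\<theta> ^ t = 1" for t
    using that unfolding T_def by (intro Least_le) auto
  have modT: "\<theta> ^ t = \<theta> ^ (t mod T)" for t
  proof -
    have "\<theta> ^ t = \<theta> ^ (T * (t div T) + t mod T)" by simp
    also have "\<dots> = \<theta> ^ (t mod T)" by (simp only: power_add power_mult T(2)) simp
    finally show ?thesis .
  qed
  have powi: "\<theta> powi k \<in> (\<lambda>t. \<theta> ^ t) ` {..<T}" for k :: int
  proof -
    have "\<theta> powi k = \<theta> powi (int T * (k div int T) + k mod int T)" by simp
    also have "\<dots> = \<theta> powi (k mod int T)"
      using nz T(2) by (subst power_int_add) (auto simp: power_int_mult)
    also have "\<dots> = \<theta> ^ nat (k mod int T)"
      using T(1) by (simp add: power_int_def)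
    finally show ?thesis using T(1) by (auto simp: nat_less_iff)
  qed
  have units: "(\<lambda>t. \<theta> ^ t) ` {..<T} = UNIV - {0}"
  proof
    show "(\<lambda>t. \<theta> ^ t) ` {..<T} \<subseteq> UNIV - {0}" using nz by auto
    show "UNIV - {0} \<subseteq> (\<lambda>t. \<theta> ^ t) ` {..<T}"
      unfolding gen[unfolded generates_units_def, symmetric] by (rule image_subsetI) (rule powi)
  qed
  have "inj_on (\<lambda>t. \<theta> ^ t) {..<T}"
  proof (rule linorder_inj_onI')
    fix i j assume "i \<in> {..<T}" "j \<in> {..<T}" "i < j"
    then show "\<theta> ^ i \<noteq> \<theta> ^ j" using cancel[of i j] least[of "j - i"] by auto
  qed
  from card_image[OF this] have card: "CARD('a) - 1 = T"
    unfolding units by (simp add: card_Diff_singleton)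
  show "\<exists>k. y = \<theta> ^ k" if "y \<noteq> 0" using units that by blast
  show "\<theta> ^ t = 1 \<longleftrightarrow> CARD('a) - 1 dvd t"
  proof
    assume "\<theta> ^ t = 1"
    then have "\<theta> ^ (t mod T) = 1" using modT[of t] by simp
    moreover have "t mod T < T" using T(1) by simp
    ultimately have "t mod T = 0" using least[of "t mod T"] by (cases "t mod T = 0") auto
    then show "CARD('a) - 1 dvd t" unfolding card by (simp add: mod_eq_0_iff_dvd)
  next
    assume "CARD('a) - 1 dvd t"
    then obtain k where "t = T * k" unfolding card by (elim dvdE)
    then show "\<theta> ^ t = 1" using T(2) by (simp add: power_mult)
  qed
qed

lemma frobenius_additive:
  fixes a b :: "'a::{field,finite}"
  assumes "primepow q" and "CARD('a) = q ^ r"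
  shows "(a + b) ^ q = a ^ q + b ^ q" and "(a - b) ^ q = a ^ q - b ^ q"
proof -
  obtain p e where pe: "prime p" "q = p ^ e"
    using assms(1) by (auto simp: primepow_def)
  have prime: "prime CHAR('a)"
    by (intro prime_CHAR_semidom finite_imp_CHAR_pos) auto
  have "CHAR('a) dvd p ^ (e * r)"
    using CHAR_dvd_CARD[where 'a = 'a] assms(2) by (simp add: pe power_mult)
  then have "CHAR('a) = p"
    using prime pe(1) by (meson prime_dvd_power primes_dvd_imp_eq)
  then have add: "(x + y) ^ q = x ^ q + y ^ q" for x y :: 'a
    using freshmans_dream'[OF prime] pe by blast
  show "(a + b) ^ q = a ^ q + b ^ q" by (rule add)
  show "(a - b) ^ q = a ^ q - b ^ q"
    using add[of "a - b" b] by (simp add: algebra_simps)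
qed

section \<open>Singer sets\<close>

text \<open>
  The data of Singer's construction. The field \<open>'a\<close> has \<open>q\<^sup>3\<close> elements and is viewed as a cubic
  extension of \<open>{x. x ^ q = x}\<close>.
\<close>

locale singer =
  fixes q :: nat and \<theta> c :: "'a::{field,finite}"
  assumes q: "primepow q" and card: "CARD('a) = q ^ 3"
    and gen: "generates_units \<theta>" and c: "c \<noteq> 0"
begin

abbreviation "N \<equiv> singer_modulus q"

lemma q_ge_2: "q \<ge> 2"
  using primepow_gt_Suc_0[OF q] by simp

lemma card_minus_1: "CARD('a) - 1 = (q - 1) * N"
proof -
  obtain r where "q = Suc r" using q_ge_2 by (cases q) auto
  then show ?thesis
    by (simp add: card singer_modulus_def power2_eq_square power3_eq_cube algebra_simps)
qed

lemma N_pos: "N > 0" by (simp add: singer_modulus_def)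

lemma power_card: "(x::'a) ^ (q ^ 3) = x"
proof (cases "x = 0")
  case True then show ?thesis using q_ge_2 by simp
next
  case False
  then obtain k where k: "x = \<theta> ^ k" using generator_surj[OF gen] by blast
  have "q ^ 3 = Suc (CARD('a) - 1)" using q_ge_2 card by simp
  then have "x ^ (q ^ 3) = x * x ^ (CARD('a) - 1)" by (simp only: power_Suc)
  also have "x ^ (CARD('a) - 1) = \<theta> ^ ((CARD('a) - 1) * k)"
    unfolding k by (metis power_mult mult.commute)
  also have "\<theta> ^ ((CARD('a) - 1) * k) = 1"
    using generator_power_eq_1_iff[OF gen] by (meson dvd_triv_left)
  finally show ?thesis by simp
qed

lemma frob_frob: "((x::'a) ^ q) ^ q = x ^ (q ^ 2)"
  by (metis power2_eq_square power_mult)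

lemma frob_cubed: "((x::'a) ^ (q ^ 2)) ^ q = x"
proof -
  have "(x ^ (q ^ 2)) ^ q = x ^ (q ^ 3)"
    by (simp only: power2_eq_square power3_eq_cube power_mult)
  then show ?thesis by (simp add: power_card)
qed

lemma trace_eq: "cubic_trace q (x::'a) = x + x ^ q + x ^ (q ^ 2)"
  by (simp add: cubic_trace_def numeral_3_eq_3 power2_eq_square)

lemma in_subfield_iff: "(\<theta> ^ d) ^ q = \<theta> ^ d \<longleftrightarrow> N dvd d"
proof -
  have "Suc (q - 1) = q" using q_ge_2 by simp
  then have "(\<theta> ^ d) ^ q = (\<theta> ^ d) ^ (q - 1) * \<theta> ^ d"
    by (metis power_Suc2)
  then have "(\<theta> ^ d) ^ q = \<theta> ^ d \<longleftrightarrow> (\<theta> ^ d) ^ (q - 1) = 1"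
    using generates_units_nonzero[OF gen] by simp
  also have "\<dots> \<longleftrightarrow> (q - 1) * N dvd (q - 1) * d"
    by (simp only: generator_power_eq_1_iff[OF gen] card_minus_1 mult.commute flip: power_mult)
  also have "\<dots> \<longleftrightarrow> N dvd d" using q_ge_2 by simp
  finally show ?thesis .
qed

lemma trace_periodic:
  "cubic_trace q (b * \<theta> ^ (k mod N)) = 0 \<longleftrightarrow> cubic_trace q (b * \<theta> ^ k) = 0"
proof -
  define s where "s = \<theta> ^ (N * (k div N))"
  have s: "s ^ q = s" by (simp add: s_def in_subfield_iff)
  then have s2: "s ^ (q ^ 2) = s" by (simp flip: frob_frob)
  have s0: "s \<noteq> 0" using generates_units_nonzero[OF gen] by (simp add: s_def)
  have "\<theta> ^ k = s * \<theta> ^ (k mod N)" by (simp add: s_def flip: power_add)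
  then have "cubic_trace q (b * \<theta> ^ k) = s * cubic_trace q (b * \<theta> ^ (k mod N))"
    by (simp only: trace_eq power_mult_distrib s s2) (simp add: algebra_simps)
  then show ?thesis using s0 by simp
qed

text \<open>
  The hypothesis \<open>b * c ^ q \<noteq> c * b ^ q\<close> says that \<open>b / c\<close> is not in the subfield, so that the two
  hyperplanes are distinct; the conclusion says that \<open>y / z\<close> is in it when \<open>y\<close> and \<open>z\<close> are nonzero.
\<close>

lemma common_zero_unique:
  assumes "b * c ^ q \<noteq> c * b ^ q"
    and "cubic_trace q (c * y) = 0" "cubic_trace q (b * y) = 0"
    and "cubic_trace q (c * z) = 0" "cubic_trace q (b * z) = 0"
  shows "y ^ q * z = z ^ q * (y::'a)"
proof -
  \<comment> \<open>The term \<open>x ^ q\<^sup>2\<close> is eliminated between the two trace equations.\<close>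
  define A where "A = c * b ^ (q ^ 2) - b * c ^ (q ^ 2)"
  define B where "B = c ^ q * b ^ (q ^ 2) - b ^ q * c ^ (q ^ 2)"
  have elim: "A * x + B * x ^ q = 0" if "cubic_trace q (c * x) = 0" "cubic_trace q (b * x) = 0" for x
  proof -
    have "A * x + B * x ^ q = b ^ (q ^ 2) * cubic_trace q (c * x) - c ^ (q ^ 2) * cubic_trace q (b * x)"
      by (simp add: A_def B_def trace_eq power_mult_distrib algebra_simps)
    then show ?thesis using that by simp
  qed
  have "B = (c * b ^ q - b * c ^ q) ^ q"
    by (simp add: B_def frobenius_additive[OF q card] power_mult_distrib frob_frob)
  then have "B \<noteq> 0" using assms(1) by auto
  moreover have "B * (y ^ q * z - z ^ q * y) = (A * y + B * y ^ q) * z - (A * z + B * z ^ q) * y"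
    by (simp add: algebra_simps)
  ultimately show ?thesis using elim[OF assms(2,3)] elim[OF assms(4,5)] by simp
qed

text \<open>
  With \<open>u = c b\<^sup>q - b c\<^sup>q\<close>, the cross product of \<open>(c, c\<^sup>q, c ^ q\<^sup>2)\<close> and \<open>(b, b\<^sup>q, b ^ q\<^sup>2)\<close> is
  \<open>(u\<^sup>q, u ^ q\<^sup>2, u)\<close>. This is the vector of conjugates of \<open>y = u\<^sup>q\<close>, and its orthogonality to the
  two factors is the vanishing of both traces.
\<close>

lemma common_zero_exists:
  assumes "b * c ^ q \<noteq> c * b ^ q"
  shows "\<exists>y. y \<noteq> 0 \<and> cubic_trace q (c * y) = 0 \<and> cubic_trace q (b * y) = (0::'a)"
proof -
  define u where "u = c * b ^ q - b * c ^ q"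
  have "u \<noteq> 0" using assms by (simp add: u_def)
  have u1: "u ^ q = c ^ q * b ^ (q ^ 2) - b ^ q * c ^ (q ^ 2)"
    by (simp add: u_def frobenius_additive[OF q card] power_mult_distrib frob_frob)
  have u2: "(u ^ q) ^ q = c ^ (q ^ 2) * b - b ^ (q ^ 2) * c"
    unfolding u1 by (simp add: frobenius_additive[OF q card] power_mult_distrib frob_frob frob_cubed)
  have u3: "(u ^ q) ^ (q ^ 2) = u"
    unfolding frob_frob[symmetric, of "u ^ q"] u2
    by (simp add: frobenius_additive[OF q card] power_mult_distrib frob_cubed u_def mult.commute)
  have tr: "cubic_trace q (x * u ^ q) =
      x * (c ^ q * b ^ (q ^ 2) - b ^ q * c ^ (q ^ 2))
      + x ^ q * (c ^ (q ^ 2) * b - b ^ (q ^ 2) * c) + x ^ (q ^ 2) * (c * b ^ q - b * c ^ q)" for x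
    unfolding trace_eq power_mult_distrib u2 u3 unfolding u1 unfolding u_def ..
  have "cubic_trace q (c * u ^ q) = 0 \<and> cubic_trace q (b * u ^ q) = 0"
    unfolding tr by (simp add: algebra_simps)
  then show ?thesis using \<open>u \<noteq> 0\<close> by (intro exI[of _ "u ^ q"]) auto
qed

lemma singer_perfect_difference_set: "perfect_difference_set N (singer_set q \<theta> c)"
  unfolding perfect_difference_set_def
proof (intro conjI ballI)
  show "singer_set q \<theta> c \<subseteq> {..<N}" by (auto simp: singer_set_def)
  fix d assume d: "d \<in> {1..<N}"
  define b where "b = c * \<theta> ^ d"
  have nz: "\<theta> \<noteq> 0" using generates_units_nonzero[OF gen] .
  have "\<not> N dvd d" using d by (simp add: nat_dvd_not_less)
  then have bc: "b * c ^ q \<noteq> c * b ^ q"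
    using c in_subfield_iff[of d] by (simp add: b_def power_mult_distrib)
  have mem: "k \<in> singer_set q \<theta> c \<and> (k + d) mod N \<in> singer_set q \<theta> c \<longleftrightarrow>
      k < N \<and> cubic_trace q (c * \<theta> ^ k) = 0 \<and> cubic_trace q (b * \<theta> ^ k) = 0" for k
  proof -
    have "c * \<theta> ^ (k + d) = b * \<theta> ^ k" by (simp add: b_def power_add)
    then have "cubic_trace q (c * \<theta> ^ ((k + d) mod N)) = 0 \<longleftrightarrow> cubic_trace q (b * \<theta> ^ k) = 0"
      using trace_periodic[of c "k + d"] by simp
    then show ?thesis using N_pos by (auto simp: singer_set_def)
  qed
  show "\<exists>!k. k \<in> singer_set q \<theta> c \<and> (k + d) mod N \<in> singer_set q \<theta> c"
    unfolding mem
  proof (rule ex_ex1I)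
    obtain y where y: "y \<noteq> 0" "cubic_trace q (c * y) = 0" "cubic_trace q (b * y) = 0"
      using common_zero_exists[OF bc] by blast
    obtain k where "y = \<theta> ^ k" using generator_surj[OF gen y(1)] by blast
    then show "\<exists>k<N. cubic_trace q (c * \<theta> ^ k) = 0 \<and> cubic_trace q (b * \<theta> ^ k) = 0"
      using y N_pos by (intro exI[of _ "k mod N"]) (simp add: trace_periodic)
  next
    have wlog: "k = l" if "k \<le> l" "l < N"
        "cubic_trace q (c * \<theta> ^ k) = 0" "cubic_trace q (b * \<theta> ^ k) = 0"
        "cubic_trace q (c * \<theta> ^ l) = 0" "cubic_trace q (b * \<theta> ^ l) = 0" for k l
    proof -
      define e where "e = l - k"
      have l: "\<theta> ^ l = \<theta> ^ e * \<theta> ^ k" using that by (simp add: e_def flip: power_add)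
      have "(\<theta> ^ k) ^ q * \<theta> ^ l = (\<theta> ^ l) ^ q * \<theta> ^ k"
        using common_zero_unique[OF bc, of "\<theta> ^ k" "\<theta> ^ l"] that nz by simp
      then have "(\<theta> ^ e) ^ q = \<theta> ^ e"
        unfolding l using nz by (simp add: power_mult_distrib)
      then have "N dvd e" by (simp add: in_subfield_iff)
      moreover have "e < N" using that by (simp add: e_def)
      ultimately have "e = 0" using nat_dvd_not_less by blast
      then show "k = l" using that by (simp add: e_def)
    qed
    fix k l
    assume "k < N \<and> cubic_trace q (c * \<theta> ^ k) = 0 \<and> cubic_trace q (b * \<theta> ^ k) = 0"
      and "l < N \<and> cubic_trace q (c * \<theta> ^ l) = 0 \<and> cubic_trace q (b * \<theta> ^ l) = 0"
    then show "k = l" using wlog[of k l] wlog[of l k] by (cases "k \<le> l") auto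
  qed
qed

end

section \<open>Weighted families with frame bounds close to one\<close>

lemma underdetermined_system_nontrivial_solution:
  fixes e :: "'i \<Rightarrow> 'k \<Rightarrow> 'a::field"
  assumes "finite I" "finite D" "card I < card D"
  shows "\<exists>a. (\<exists>k\<in>D. a k \<noteq> 0) \<and> (\<forall>i\<in>I. (\<Sum>k\<in>D. a k * e i k) = 0)"
  using assms
proof (induction I arbitrary: D e rule: finite_induct)
  case empty
  then obtain k where "k \<in> D" by fastforce
  then show ?case by (intro exI[of _ "\<lambda>_. 1"]) auto
next
  case (insert i I)
  show ?case
  proof (cases "\<forall>k\<in>D. e i k = 0")
    case True
    have "card I < card D" using insert.prems insert.hyps by simp
    then obtain a where "\<exists>k\<in>D. a k \<noteq> 0" "\<forall>j\<in>I. (\<Sum>k\<in>D. a k * e j k) = 0"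
      using insert.IH[OF insert.prems(1)] by blast
    then show ?thesis using True by (intro exI[of _ a]) auto
  next
    case False
    then obtain p where p: "p \<in> D" "e i p \<noteq> 0" by blast
    \<comment> \<open>Eliminate the unknown \<open>p\<close> with the equation \<open>i\<close>.\<close>
    define r where "r = (\<lambda>j k. e j k - e i k / e i p * e j p)"
    have "finite (D - {p})" "card I < card (D - {p})"
      using insert.prems insert.hyps p by auto
    from insert.IH[OF this] obtain a where a: "\<exists>k\<in>D - {p}. a k \<noteq> 0"
      "\<forall>j\<in>I. (\<Sum>k\<in>D - {p}. a k * r j k) = 0" by blast
    define b where "b = a(p := - (\<Sum>k\<in>D - {p}. a k * e i k) / e i p)"
    have sum_b: "(\<Sum>k\<in>D. b k * e j k) = (\<Sum>k\<in>D - {p}. a k * r j k)" for j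
    proof -
      have "(\<Sum>k\<in>D. b k * e j k) = b p * e j p + (\<Sum>k\<in>D - {p}. b k * e j k)"
        using insert.prems(1) p(1) by (rule sum.remove)
      also have "(\<Sum>k\<in>D - {p}. b k * e j k) = (\<Sum>k\<in>D - {p}. a k * e j k)"
        by (rule sum.cong) (auto simp: b_def)
      also have "b p * e j p + \<dots> = (\<Sum>k\<in>D - {p}. a k * r j k)"
        by (simp add: b_def r_def right_diff_distrib sum_subtractf sum_distrib_right
            sum_distrib_left sum_divide_distrib mult_ac)
      finally show ?thesis .
    qed
    have "r i k = 0" for k using p(2) by (simp add: r_def)
    then have "(\<Sum>k\<in>D. b k * e j k) = 0" if "j \<in> insert i I" for j
      unfolding sum_b using a(2) that by auto
    moreover have "\<exists>k\<in>D. b k \<noteq> 0" using a(1) by (auto simp: b_def)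
    ultimately show ?thesis by blast
  qed
qed

text \<open>
  The left-hand side is twice the real part of \<open>\<langle>(A - I) a, b\<rangle>\<close>, where \<open>A\<close> is the frame operator of
  the vectors \<open>cnj e\<^sub>i\<close> with weights \<open>u\<^sub>i\<close>. The hypotheses say that \<open>\<bar>\<langle>(A - I) a, a\<rangle>\<bar> \<le> \<epsilon> \<langle>a, a\<rangle>\<close>; the
  bound carries over to all pairs by polarisation and the parallelogram law.
\<close>

lemma polarised_form_bound:
  fixes e :: "'i \<Rightarrow> 'k \<Rightarrow> complex" and u :: "'i \<Rightarrow> real" and D :: "'k set"
  defines "F \<equiv> \<lambda>a i. \<Sum>k\<in>D. a k * e i k"
  assumes lower: "\<And>a. (1 - \<epsilon>) * (\<Sum>k\<in>D. (cmod (a k))\<^sup>2) \<le> (\<Sum>i\<in>I. u i * (cmod (F a i))\<^sup>2)"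
    and upper: "\<And>a. (\<Sum>i\<in>I. u i * (cmod (F a i))\<^sup>2) \<le> (1 + \<epsilon>) * (\<Sum>k\<in>D. (cmod (a k))\<^sup>2)"
  shows "2 * ((\<Sum>i\<in>I. u i * Re (F a i * cnj (F b i))) - (\<Sum>k\<in>D. Re (a k * cnj (b k))))
    \<le> \<epsilon> * ((\<Sum>k\<in>D. (cmod (a k))\<^sup>2) + (\<Sum>k\<in>D. (cmod (b k))\<^sup>2))"
proof -
  have polar: "(cmod (x + y))\<^sup>2 - (cmod (x - y))\<^sup>2 = 4 * Re (x * cnj y)"
    and parallel: "(cmod (x + y))\<^sup>2 + (cmod (x - y))\<^sup>2 = 2 * ((cmod x)\<^sup>2 + (cmod y)\<^sup>2)" for x y
    unfolding cmod_power2 by (simp_all add: power2_eq_square algebra_simps)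
  have add: "F (\<lambda>k. a k + b k) i = F a i + F b i" and diff: "F (\<lambda>k. a k - b k) i = F a i - F b i" for i
    by (simp_all add: F_def algebra_simps sum.distrib sum_subtractf)
  have "(\<Sum>i\<in>I. u i * (cmod (F a i + F b i))\<^sup>2) - (\<Sum>i\<in>I. u i * (cmod (F a i - F b i))\<^sup>2)
      = 4 * (\<Sum>i\<in>I. u i * Re (F a i * cnj (F b i)))"
    unfolding sum_subtractf[symmetric] right_diff_distrib[symmetric] polar sum_distrib_left
    by (simp only: mult_ac)
  moreover have "(\<Sum>k\<in>D. (cmod (a k + b k))\<^sup>2) - (\<Sum>k\<in>D. (cmod (a k - b k))\<^sup>2)
      = 4 * (\<Sum>k\<in>D. Re (a k * cnj (b k)))"
    unfolding sum_subtractf[symmetric] polar sum_distrib_left ..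
  moreover have "\<epsilon> * (\<Sum>k\<in>D. (cmod (a k + b k))\<^sup>2) + \<epsilon> * (\<Sum>k\<in>D. (cmod (a k - b k))\<^sup>2)
      = 2 * (\<epsilon> * ((\<Sum>k\<in>D. (cmod (a k))\<^sup>2) + (\<Sum>k\<in>D. (cmod (b k))\<^sup>2)))"
    unfolding distrib_left[symmetric] sum.distrib[symmetric] parallel
    by (simp add: sum_distrib_left mult_ac)
  moreover have "(\<Sum>i\<in>I. u i * (cmod (F a i + F b i))\<^sup>2) \<le>
      (\<Sum>k\<in>D. (cmod (a k + b k))\<^sup>2) + \<epsilon> * (\<Sum>k\<in>D. (cmod (a k + b k))\<^sup>2)"
    using upper[of "\<lambda>k. a k + b k"] unfolding add by (simp add: algebra_simps)
  moreover have "(\<Sum>k\<in>D. (cmod (a k - b k))\<^sup>2) - \<epsilon> * (\<Sum>k\<in>D. (cmod (a k - b k))\<^sup>2)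
      \<le> (\<Sum>i\<in>I. u i * (cmod (F a i - F b i))\<^sup>2)"
    using lower[of "\<lambda>k. a k - b k"] unfolding diff by (simp add: algebra_simps)
  moreover have "2 * X - 2 * Y \<le> E" if "U - U' = 4 * X" "S - S' = 4 * Y" "T + T' = 2 * E"
      "U \<le> S + T" "S' - T' \<le> U'" for U U' S S' T T' X Y E :: real
    using that by simp
  ultimately show ?thesis unfolding right_diff_distrib by blast
qed

text \<open>
  Each column of \<open>A - I\<close> has norm at most \<open>\<epsilon>\<close>: pair a unit coordinate vector with the normalised
  column in the polarised bound.
\<close>

lemma frame_column_bound:
  fixes e :: "'i \<Rightarrow> 'k \<Rightarrow> complex" and u :: "'i \<Rightarrow> real"
  assumes D: "finite D" "k \<in> D" and \<epsilon>: "0 \<le> \<epsilon>"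
    and lower: "\<And>a. (1 - \<epsilon>) * (\<Sum>k\<in>D. (cmod (a k))\<^sup>2)
      \<le> (\<Sum>i\<in>I. u i * (cmod (\<Sum>k\<in>D. a k * e i k))\<^sup>2)"
    and upper: "\<And>a. (\<Sum>i\<in>I. u i * (cmod (\<Sum>k\<in>D. a k * e i k))\<^sup>2)
      \<le> (1 + \<epsilon>) * (\<Sum>k\<in>D. (cmod (a k))\<^sup>2)"
  shows "(\<Sum>l\<in>D. (cmod ((\<Sum>i\<in>I. u i * e i k * cnj (e i l)) - of_bool (l = k)))\<^sup>2) \<le> \<epsilon>\<^sup>2"
proof -
  define B where "B l = (\<Sum>i\<in>I. u i * e i k * cnj (e i l)) - of_bool (l = k)" for l
  define P where "P = (\<Sum>l\<in>D. (cmod (B l))\<^sup>2)"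
  have bound: "2 * (s * P) \<le> \<epsilon> * (1 + s\<^sup>2 * P)" for s :: real
  proof -
    have Re_scale: "Re (complex_of_real r * z) = r * Re z" for r z by simp
    let ?a = "\<lambda>l. of_bool (l = k) :: complex" and ?b = "\<lambda>l. s * B l"
    have "complex_of_real P = (\<Sum>l\<in>D. B l * cnj (B l))"
      by (simp add: P_def complex_norm_square del: of_real_power)
    also have "\<dots> = (\<Sum>l\<in>D. \<Sum>i\<in>I. u i * (e i k * cnj (B l * e i l))) - (\<Sum>l\<in>D. of_bool (l = k) * cnj (B l))"
      by (subst (1) B_def) (simp add: algebra_simps sum_subtractf sum_distrib_left)
    also have "\<dots> = (\<Sum>i\<in>I. u i * (e i k * cnj (\<Sum>l\<in>D. B l * e i l))) - (\<Sum>l\<in>D. of_bool (l = k) * cnj (B l))"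
      by (subst sum.swap) (simp add: sum_distrib_left)
    finally have P_eq: "complex_of_real P = \<dots>" .
    have "complex_of_real (s * P) =
        (\<Sum>i\<in>I. u i * (e i k * cnj (\<Sum>l\<in>D. ?b l * e i l))) - (\<Sum>l\<in>D. ?a l * cnj (?b l))"
      unfolding of_real_mult P_eq by (simp add: right_diff_distrib sum_distrib_left mult_ac)
    from arg_cong[OF this, of Re] have sP: "s * P =
        (\<Sum>i\<in>I. u i * Re (e i k * cnj (\<Sum>l\<in>D. ?b l * e i l))) - (\<Sum>l\<in>D. Re (?a l * cnj (?b l)))"
      by (simp only: Re_complex_of_real minus_complex.sel Re_sum Re_scale)
    have col: "(\<Sum>l\<in>D. ?a l * e i l) = e i k" for i
      using D by (simp add: of_bool_def if_distrib if_distribR sum.delta cong: if_cong)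
    have "(\<Sum>l\<in>D. (cmod (?a l))\<^sup>2) = 1"
      using D by (simp add: of_bool_def if_distrib if_distribR sum.delta cong: if_cong)
    moreover have "(\<Sum>l\<in>D. (cmod (?b l))\<^sup>2) = s\<^sup>2 * P"
      by (simp add: P_def norm_mult power_mult_distrib sum_distrib_left)
    ultimately show ?thesis
      using polarised_form_bound[OF lower upper, of ?a ?b] unfolding col sP[symmetric] by simp
  qed
  have "P \<le> \<epsilon>\<^sup>2"
  proof (cases "P > 0")
    case True
    \<comment> \<open>The scaling \<open>s = 1 / sqrt P\<close> makes both arguments of the form unit vectors.\<close>
    have "1 / sqrt P * P = sqrt P" "(1 / sqrt P)\<^sup>2 * P = 1"
      using True by (simp_all add: real_div_sqrt power_divide)
    then have "sqrt P \<le> \<epsilon>" using bound[of "1 / sqrt P"] by simp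
    then have "(sqrt P)\<^sup>2 \<le> \<epsilon>\<^sup>2" using True by (intro power_mono) auto
    then show ?thesis using True by simp
  next
    case False
    then show ?thesis using zero_le_power2[of \<epsilon>] by linarith
  qed
  then show ?thesis by (simp add: P_def B_def)
qed

text \<open>
  Summing over the columns bounds the frame potential \<open>tr (A\<^sup>2)\<close>, which is the left-hand side below,
  in terms of \<open>tr A\<close>.
\<close>

lemma frame_potential_bound:
  fixes e :: "'i \<Rightarrow> 'k \<Rightarrow> complex" and u :: "'i \<Rightarrow> real"
  assumes D: "finite D" and \<epsilon>: "0 \<le> \<epsilon>"
    and lower: "\<And>a. (1 - \<epsilon>) * (\<Sum>k\<in>D. (cmod (a k))\<^sup>2)
      \<le> (\<Sum>i\<in>I. u i * (cmod (\<Sum>k\<in>D. a k * e i k))\<^sup>2)"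
    and upper: "\<And>a. (\<Sum>i\<in>I. u i * (cmod (\<Sum>k\<in>D. a k * e i k))\<^sup>2)
      \<le> (1 + \<epsilon>) * (\<Sum>k\<in>D. (cmod (a k))\<^sup>2)"
  shows "(\<Sum>i\<in>I. \<Sum>j\<in>I. u i * u j * (cmod (\<Sum>k\<in>D. e i k * cnj (e j k)))\<^sup>2)
    \<le> 2 * (\<Sum>i\<in>I. u i * (\<Sum>k\<in>D. (cmod (e i k))\<^sup>2)) - (1 - \<epsilon>\<^sup>2) * card D"
proof -
  define A where "A k l = (\<Sum>i\<in>I. u i * e i k * cnj (e i l))" for k l
  have "(\<Sum>k\<in>D. \<Sum>l\<in>D. (cmod (A k l - of_bool (l = k)))\<^sup>2) \<le> (\<Sum>k\<in>D. \<epsilon>\<^sup>2)"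
    unfolding A_def by (intro sum_mono frame_column_bound[OF D _ \<epsilon> lower upper])
  moreover have "(cmod (A k l - of_bool (l = k)))\<^sup>2
      = (cmod (A k l))\<^sup>2 + (if k = l then 1 - 2 * Re (A k k) else 0)" for k l
    unfolding cmod_power2 by (auto simp: power2_eq_square algebra_simps)
  ultimately have "(\<Sum>k\<in>D. \<Sum>l\<in>D. (cmod (A k l))\<^sup>2) + (\<Sum>k\<in>D. 1 - 2 * Re (A k k)) \<le> \<epsilon>\<^sup>2 * card D"
    using D by (simp add: sum.distrib mult.commute)
  then have ineq: "(\<Sum>k\<in>D. \<Sum>l\<in>D. (cmod (A k l))\<^sup>2) \<le> 2 * (\<Sum>k\<in>D. Re (A k k)) - (1 - \<epsilon>\<^sup>2) * card D"
    by (simp add: sum_subtractf sum_distrib_left algebra_simps)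
  have "Re (u i * e i k * cnj (e i k)) = u i * (cmod (e i k))\<^sup>2" for i k
    unfolding cmod_power2 by (simp add: power2_eq_square algebra_simps)
  then have "(\<Sum>k\<in>D. Re (A k k)) = (\<Sum>k\<in>D. \<Sum>i\<in>I. u i * (cmod (e i k))\<^sup>2)"
    by (simp only: A_def Re_sum)
  also have "\<dots> = (\<Sum>i\<in>I. u i * (\<Sum>k\<in>D. (cmod (e i k))\<^sup>2))"
    by (subst sum.swap) (simp add: sum_distrib_left)
  finally have trace: "(\<Sum>k\<in>D. Re (A k k)) = (\<Sum>i\<in>I. u i * (\<Sum>k\<in>D. (cmod (e i k))\<^sup>2))" .
  have "complex_of_real (\<Sum>k\<in>D. \<Sum>l\<in>D. (cmod (A k l))\<^sup>2)
      = (\<Sum>k\<in>D. \<Sum>l\<in>D. \<Sum>i\<in>I. \<Sum>j\<in>I.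
          u i * u j * ((e i k * cnj (e j k)) * cnj (e i l * cnj (e j l))))"
    by (simp add: complex_norm_square A_def sum_product mult_ac del: of_real_power)
  also have "\<dots> = (\<Sum>k\<in>D. \<Sum>i\<in>I. \<Sum>j\<in>I. \<Sum>l\<in>D.
          u i * u j * ((e i k * cnj (e j k)) * cnj (e i l * cnj (e j l))))"
    by (intro sum.cong refl, subst sum.swap, intro sum.cong refl, subst sum.swap) (rule refl)
  also have "\<dots> = (\<Sum>i\<in>I. \<Sum>j\<in>I. \<Sum>k\<in>D. \<Sum>l\<in>D.
          u i * u j * ((e i k * cnj (e j k)) * cnj (e i l * cnj (e j l))))"
    by (subst sum.swap, intro sum.cong refl, subst sum.swap) (rule refl)
  also have "\<dots> = (\<Sum>i\<in>I. \<Sum>j\<in>I. u i * u j *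
      ((\<Sum>k\<in>D. e i k * cnj (e j k)) * cnj (\<Sum>k\<in>D. e i k * cnj (e j k))))"
    by (simp only: cnj_sum, simp only: sum_product, simp only: sum_distrib_left)
  also have "\<dots> = complex_of_real (\<Sum>i\<in>I. \<Sum>j\<in>I. u i * u j * (cmod (\<Sum>k\<in>D. e i k * cnj (e j k)))\<^sup>2)"
    by (simp only: complex_norm_square[symmetric] of_real_sum of_real_mult)
  finally have "(\<Sum>k\<in>D. \<Sum>l\<in>D. (cmod (A k l))\<^sup>2)
      = (\<Sum>i\<in>I. \<Sum>j\<in>I. u i * u j * (cmod (\<Sum>k\<in>D. e i k * cnj (e j k)))\<^sup>2)"
    by (simp only: of_real_eq_iff)
  then show ?thesis using ineq trace by simp
qed

section \<open>Sampling on harmonic frames of difference sets\<close>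

lemma
  fixes N :: nat
  assumes "N > 0"
  defines "\<omega> \<equiv> exp (2 * complex_of_real pi * \<i> / of_nat N)"
  shows root_of_unity_quotient_power: "(\<omega> ^ j * cnj (\<omega> ^ i)) ^ N = 1"
    and root_of_unity_quotient_eq_1_iff:
      "i < N \<Longrightarrow> j < N \<Longrightarrow> \<omega> ^ j * cnj (\<omega> ^ i) = 1 \<longleftrightarrow> i = j"
proof -
  have pow: "\<omega> ^ i = exp (2 * of_real pi * \<i> * of_nat i / of_nat N)" for i
    unfolding \<omega>_def by (simp add: mult_ac flip: exp_of_nat_mult)
  have "\<omega> ^ N = 1" using assms(1) by (simp add: pow)
  then have unity: "(\<omega> ^ i) ^ N = 1" for i
    by (metis mult.commute power_mult power_one)
  have "cmod \<omega> = 1" by (simp add: \<omega>_def)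
  then have unit: "\<omega> ^ i * cnj (\<omega> ^ i) = 1" for i
    using complex_norm_square[of "\<omega> ^ i"] by (simp add: norm_power)
  show "(\<omega> ^ j * cnj (\<omega> ^ i)) ^ N = 1"
    unfolding power_mult_distrib complex_cnj_power[symmetric] unity by simp
  show "\<omega> ^ j * cnj (\<omega> ^ i) = 1 \<longleftrightarrow> i = j" if "i < N" "j < N"
  proof
    assume "\<omega> ^ j * cnj (\<omega> ^ i) = 1"
    then have "\<omega> ^ j * (\<omega> ^ i * cnj (\<omega> ^ i)) = \<omega> ^ i" by (metis mult.left_commute mult.right_neutral)
    then have "\<omega> ^ j = \<omega> ^ i" by (simp only: unit mult_1_right)
    then show "i = j"
      using complex_root_unity_eq[of N j i] assms(1) that unfolding pow by simp
  qed (simp only: unit)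
qed

lemma discrete_parseval:
  fixes N :: nat and a :: "nat \<Rightarrow> complex"
  assumes "D \<subseteq> {..<N}" and "N > 0"
  defines "\<omega> \<equiv> exp (2 * complex_of_real pi * \<i> / of_nat N)"
  shows "(\<Sum>i<N. (cmod (\<Sum>k\<in>D. a k * cnj (\<omega> ^ (i * k))))\<^sup>2) = N * (\<Sum>k\<in>D. (cmod (a k))\<^sup>2)"
proof -
  have fin: "finite D" using assms(1) by (rule finite_subset) simp
  have orth: "(\<Sum>i<N. cnj (\<omega> ^ (i * k)) * \<omega> ^ (i * l)) = (if k = l then of_nat N else 0)"
    if "k \<in> D" "l \<in> D" for k l
  proof -
    define z where "z = \<omega> ^ l * cnj (\<omega> ^ k)"
    have "(\<Sum>i<N. cnj (\<omega> ^ (i * k)) * \<omega> ^ (i * l)) = (\<Sum>i<N. z ^ i)"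
      by (simp add: z_def power_mult_distrib mult.commute flip: power_mult)
    moreover have "z ^ N = 1"
      unfolding z_def \<omega>_def by (rule root_of_unity_quotient_power[OF assms(2)])
    moreover have "z = 1 \<longleftrightarrow> k = l"
      unfolding z_def \<omega>_def using that assms(1)
      by (intro root_of_unity_quotient_eq_1_iff[OF assms(2)]) auto
    ultimately show ?thesis using geometric_sum[of z N] by auto
  qed
  have "complex_of_real (\<Sum>i<N. (cmod (\<Sum>k\<in>D. a k * cnj (\<omega> ^ (i * k))))\<^sup>2)
      = (\<Sum>i<N. (\<Sum>k\<in>D. a k * cnj (\<omega> ^ (i * k))) * cnj (\<Sum>l\<in>D. a l * cnj (\<omega> ^ (i * l))))"
    by (simp only: of_real_sum complex_norm_square)
  also have "\<dots> = (\<Sum>i<N. \<Sum>k\<in>D. \<Sum>l\<in>D.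
      (a k * cnj (a l)) * (cnj (\<omega> ^ (i * k)) * \<omega> ^ (i * l)))"
    by (simp add: sum_product mult_ac)
  also have "\<dots> = (\<Sum>k\<in>D. \<Sum>l\<in>D. \<Sum>i<N.
      (a k * cnj (a l)) * (cnj (\<omega> ^ (i * k)) * \<omega> ^ (i * l)))"
    by (subst sum.swap, rule sum.cong, rule refl, rule sum.swap)
  also have "\<dots> = (\<Sum>k\<in>D. \<Sum>l\<in>D. (a k * cnj (a l)) * (if k = l then of_nat N else 0))"
    by (intro sum.cong refl) (simp only: orth flip: sum_distrib_left)
  also have "\<dots> = (\<Sum>k\<in>D. a k * cnj (a k) * of_nat N)"
    using fin by (simp add: if_distrib cong: if_cong)
  also have "\<dots> = complex_of_real (N * (\<Sum>k\<in>D. (cmod (a k))\<^sup>2))"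
    by (simp add: sum_distrib_left complex_norm_square mult_ac del: of_real_power)
  finally show ?thesis by (simp only: of_real_eq_iff)
qed

text \<open>
  The normalisations \<open>sqrt (m / N)\<close> of the function space and \<open>1 / sqrt m\<close> of the frame vectors
  combine to \<open>1 / sqrt N\<close>, so that \<open>a \<mapsto> f\<^sub>a\<close> is an isometry by Parseval.
\<close>

lemma cmod_frame_function_sq:
  "(cmod (frame_function q D a i))\<^sup>2 =
    (cmod (\<Sum>k\<in>D. a k *
      cnj (exp (2 * complex_of_real pi * \<i> / of_nat (singer_modulus q)) ^ (i * k))))\<^sup>2
    / singer_modulus q"
proof -
  define s where "s = (\<Sum>k\<in>D. a k *
    cnj (exp (2 * complex_of_real pi * \<i> / of_nat (singer_modulus q)) ^ (i * k)))"
  have "inner_on D a (singer_frame q i) = s / complex_of_real (sqrt (real (q + 1)))"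
    unfolding inner_on_def singer_frame_def s_def
    by (simp add: sum_divide_distrib)
  then have "cmod (frame_function q D a i)
      = sqrt (real (q + 1) / real (singer_modulus q)) * (cmod s / sqrt (real (q + 1)))"
    by (simp add: frame_function_def norm_mult norm_divide)
  moreover have "real (q + 1) > 0" by simp
  ultimately have "(cmod (frame_function q D a i))\<^sup>2 = (cmod s)\<^sup>2 / singer_modulus q"
    by (simp add: power_mult_distrib power_divide del: of_nat_add)
  then show ?thesis unfolding s_def .
qed

text \<open>
  Both sampling bounds hold for the harmonic frame of any perfect difference set of modulus
  \<open>q\<^sup>2 + q + 1\<close> with \<open>q > 0\<close>; the second one is stated without division.
\<close>

lemma difference_set_frame_MZ_bounds:
  fixes x :: "nat \<Rightarrow> nat" and w :: "nat \<Rightarrow> real" and \<epsilon> :: real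
  assumes D: "perfect_difference_set (singer_modulus q) D" and q: "q > 0"
    and \<epsilon>: "0 \<le> \<epsilon>" "\<epsilon> < 1"
    and x: "inj_on x {1..n}" "x ` {1..n} \<subseteq> {..<singer_modulus q}"
    and w: "\<forall>i\<in>{1..n}. w i > 0"
    and MZ: "weighted_MZ (singer_modulus q) (frame_space q D) n x w \<epsilon>"
  shows "q + 1 \<le> n"
    and "singer_modulus q * (1 - \<epsilon>\<^sup>2) \<le> n * (1 + q * \<epsilon>\<^sup>2)"
proof -
  define N where "N = singer_modulus q"
  define \<omega> where "\<omega> = exp (2 * complex_of_real pi * \<i> / of_nat N)"
  define e where "e i k = cnj (\<omega> ^ (x i * k))" for i k
  define u where "u i = w i / N" for i
  have N: "N = q ^ 2 + q + 1" "N > 0" by (simp_all add: N_def singer_modulus_def)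
  have D_sub: "D \<subseteq> {..<N}" using D by (simp add: perfect_difference_set_def N_def)
  then have fin: "finite D" by (rule finite_subset) simp
  have cardD: "card D = q + 1"
    using perfect_difference_set_card D q by (simp add: singer_modulus_def)
  have norm: "L2_norm_sq N (frame_function q D a) = (\<Sum>k\<in>D. (cmod (a k))\<^sup>2)" for a
    unfolding L2_norm_sq_def cmod_frame_function_sq N_def[symmetric] sum_divide_distrib[symmetric]
      discrete_parseval[OF D_sub N(2)] using N(2) by simp
  have sampled: "(\<Sum>i=1..n. w i * (cmod (frame_function q D a (x i)))\<^sup>2)
      = (\<Sum>i=1..n. u i * (cmod (\<Sum>k\<in>D. a k * e i k))\<^sup>2)" for a
    unfolding cmod_frame_function_sq N_def[symmetric] u_def e_def \<omega>_def by simp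
  have lower: "(1 - \<epsilon>) * (\<Sum>k\<in>D. (cmod (a k))\<^sup>2) \<le> (\<Sum>i=1..n. u i * (cmod (\<Sum>k\<in>D. a k * e i k))\<^sup>2)"
    and upper: "(\<Sum>i=1..n. u i * (cmod (\<Sum>k\<in>D. a k * e i k))\<^sup>2) \<le> (1 + \<epsilon>) * (\<Sum>k\<in>D. (cmod (a k))\<^sup>2)"
    for a
    using MZ
    unfolding weighted_MZ_def frame_space_def norm[symmetric] sampled[symmetric] N_def[symmetric]
    by blast+
  show n: "q + 1 \<le> n"
  proof (rule ccontr)
    assume "\<not> q + 1 \<le> n"
    then have "card {1..n} < card D" by (simp add: cardD)
    then obtain a where a: "\<exists>k\<in>D. a k \<noteq> 0" "\<forall>i\<in>{1..n}. (\<Sum>k\<in>D. a k * e i k) = 0"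
      using underdetermined_system_nontrivial_solution[of "{1..n}" D e] fin by auto
    have "(\<Sum>k\<in>D. (cmod (a k))\<^sup>2) > 0"
      using a(1) fin by (auto intro: sum_pos2)
    then have "(1 - \<epsilon>) * (\<Sum>k\<in>D. (cmod (a k))\<^sup>2) > 0" using \<epsilon> by simp
    moreover have "(\<Sum>i=1..n. u i * (cmod (\<Sum>k\<in>D. a k * e i k))\<^sup>2) = 0"
      using a(2) by simp
    ultimately show False using lower[of a] by linarith
  qed
  \<comment> \<open>Equiangularity: the squared inner products are \<open>q\<close> off the diagonal and \<open>(q + 1)\<^sup>2 = q + N\<close> on it.\<close>
  have corr: "(cmod (\<Sum>k\<in>D. e i k * cnj (e j k)))\<^sup>2 = q + (if j = i then real N else 0)"
    if "i \<in> {1..n}" "j \<in> {1..n}" for i j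
  proof -
    define z where "z = \<omega> ^ x j * cnj (\<omega> ^ x i)"
    have "(\<Sum>k\<in>D. e i k * cnj (e j k)) = (\<Sum>k\<in>D. z ^ k)"
      by (simp add: e_def z_def power_mult_distrib mult.commute flip: power_mult)
    moreover have "z = 1 \<longleftrightarrow> j = i"
      using root_of_unity_quotient_eq_1_iff[OF N(2), of "x i" "x j"] that x
      by (auto simp: z_def \<omega>_def N_def inj_on_eq_iff image_subset_iff simp del: complex_cnj_power)
    moreover have "z ^ N = 1"
      unfolding z_def \<omega>_def by (rule root_of_unity_quotient_power[OF N(2)])
    moreover have "(cmod (1 + of_nat q))\<^sup>2 = q + real N"
    proof -
      have "cmod (1 + of_nat q) = real (q + 1)"
        using norm_of_nat[of "Suc q", where 'a = complex] by simp
      then show ?thesis by (simp add: N(1) power2_eq_square algebra_simps)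
    qed
    ultimately show ?thesis
      using perfect_difference_set_character_sum_nontrivial[OF D[folded N_def] N(2), of z]
      by (auto simp: cardD)
  qed
  define W where "W = (\<Sum>i=1..n. u i)"
  define S where "S = (\<Sum>i=1..n. (u i)\<^sup>2)"
  have "(\<Sum>i=1..n. \<Sum>j=1..n. u i * u j * (cmod (\<Sum>k\<in>D. e i k * cnj (e j k)))\<^sup>2)
      = (\<Sum>i=1..n. \<Sum>j=1..n. u i * u j * (q + (if j = i then real N else 0)))"
    by (intro sum.cong refl) (simp add: corr)
  also have "\<dots> = (\<Sum>i=1..n. q * u i * W + N * (u i)\<^sup>2)"
  proof (intro sum.cong refl)
    fix i assume i: "i \<in> {1..n}"
    have "u i * u j * (q + (if j = i then real N else 0))
        = q * u i * u j + (if j = i then N * (u i)\<^sup>2 else 0)" for j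
      by (simp add: power2_eq_square algebra_simps)
    then show "(\<Sum>j=1..n. u i * u j * (q + (if j = i then real N else 0)))
        = q * u i * W + N * (u i)\<^sup>2"
      using i by (simp only: sum.distrib flip: sum_distrib_left) (simp add: W_def)
  qed
  also have "\<dots> = q * W\<^sup>2 + N * S"
    by (simp add: sum.distrib S_def W_def power2_eq_square
        flip: sum_distrib_left sum_distrib_right)
  finally have potential: "(\<Sum>i=1..n. \<Sum>j=1..n. u i * u j * (cmod (\<Sum>k\<in>D. e i k * cnj (e j k)))\<^sup>2)
      = q * W\<^sup>2 + N * S" .
  have "(cmod (e i k))\<^sup>2 = 1" for i k
    by (simp add: e_def \<omega>_def norm_power)
  then have "(\<Sum>i=1..n. u i * (\<Sum>k\<in>D. (cmod (e i k))\<^sup>2)) = W * (q + 1)"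
    by (simp add: cardD W_def sum_distrib_right)
  with frame_potential_bound[OF fin \<epsilon>(1) lower upper] potential
  have bound: "q * W\<^sup>2 + N * S \<le> (q + 1) * (2 * W - (1 - \<epsilon>\<^sup>2))"
    by (simp add: cardD algebra_simps)
  define \<delta> where "\<delta> = 1 - \<epsilon>\<^sup>2"
  have \<delta>: "\<delta> > 0" using \<epsilon> by (simp add: \<delta>_def power_less_one_iff abs_square_less_1)
  have "W > 0" unfolding W_def u_def using w n N(2) by (intro sum_pos) auto
  have "W\<^sup>2 \<le> n * S"
    using sum_squared_le_sum_of_squares[of u "{1..n}"] by (simp add: W_def S_def mult.commute)
  then have "(n * q + N) * W\<^sup>2 \<le> n * (q * W\<^sup>2 + N * S)"
    by (simp add: algebra_simps)
      (metis mult.left_commute mult_left_mono of_nat_0_le_iff)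
  also have "\<dots> \<le> n * ((q + 1) * (2 * W - \<delta>))"
    using bound by (intro mult_left_mono) (simp_all add: \<delta>_def)
  finally have "\<delta> * ((n * q + N) * W\<^sup>2) \<le> \<delta> * (n * ((q + 1) * (2 * W - \<delta>)))"
    using \<delta> by (intro mult_left_mono) auto
  also have "\<dots> = n * (q + 1) * (\<delta> * (2 * W - \<delta>))" by (simp add: algebra_simps)
  \<comment> \<open>For fixed \<open>W\<close>, the maximum of \<open>\<delta> (2 W - \<delta>)\<close> over \<open>\<delta>\<close> is \<open>W\<^sup>2\<close>.\<close>
  also have "\<dots> \<le> n * (q + 1) * W\<^sup>2"
  proof (rule mult_left_mono)
    show "\<delta> * (2 * W - \<delta>) \<le> W\<^sup>2"
      using zero_le_power2[of "W - \<delta>"] by (simp add: power2_eq_square algebra_simps)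
  qed simp
  finally have "(\<delta> * (n * q + N)) * W\<^sup>2 \<le> (n * (q + 1)) * W\<^sup>2" by (simp add: mult_ac)
  then have "\<delta> * (n * q + N) \<le> n * (q + 1)" using \<open>W > 0\<close> by simp
  then show "singer_modulus q * (1 - \<epsilon>\<^sup>2) \<le> n * (1 + q * \<epsilon>\<^sup>2)"
    by (simp add: \<delta>_def algebra_simps flip: N_def)
qed

theorem corollary3p5:
  fixes m n :: nat
    and \<theta> c :: "'a::{field,finite}"
    and x :: "nat \<Rightarrow> nat" and w :: "nat \<Rightarrow> real" and \<epsilon> :: real
  assumes "primepow (m - 1)"
    and "CARD('a) = (m - 1) ^ 3"
    and "generates_units \<theta>"
    and "c \<noteq> 0"
    and "0 \<le> \<epsilon>" and "\<epsilon> < 1"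
    and "inj_on x {1..n}"
    and "x ` {1..n} \<subseteq> {..<singer_modulus (m - 1)}"
    and "\<forall>i\<in>{1..n}. w i > 0"
    and "weighted_MZ (singer_modulus (m - 1))
           (frame_space (m - 1) (singer_set (m - 1) \<theta> c)) n x w \<epsilon>"
  shows "real n \<ge> max (real m)
           (((real m)\<^sup>2 - real m + 1) * (1 - \<epsilon>\<^sup>2) / (1 + (real m - 1) * \<epsilon>\<^sup>2))"
proof -
  define q where "q = m - 1"
  have q_pos: "q > 0" using primepow_gt_Suc_0[OF assms(1)] by (simp add: q_def)
  then have m: "m = q + 1" by (simp add: q_def)
  interpret singer q \<theta> c by standard (use assms(1-4) in \<open>simp_all add: q_def\<close>)
  note bounds = difference_set_frame_MZ_bounds[OF singer_perfect_difference_set q_pos assms(5-7)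
      assms(8)[folded q_def] assms(9) assms(10)[folded q_def]]
  have "(real m)\<^sup>2 - real m + 1 = singer_modulus q" "real m - 1 = real q"
    by (simp_all add: m singer_modulus_def power2_eq_square algebra_simps)
  moreover have "1 + real q * \<epsilon>\<^sup>2 > 0" by (simp add: add_pos_nonneg)
  ultimately show ?thesis
    using bounds by (simp add: m pos_divide_le_eq)
qed

end
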